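(* Let $G_2=\langle x,y \,\|\, xy^{-1}x^{-1}yx=y^{-2}xyx^{-1}y^{-1}xy^{2}\rangle$ and let $B_2=\mathbb{Q}[[X,Y]]/\langle X^2,Y^2\rangle$. Then the assignment $$x\mapsto 1+X,\qquad y\mapsto 1+Y$$ defines a representation of $G_2$ in the algebra $B_2/\langle XY-YX\rangle$ (that is, it extends to a homomorphism from $G_2$ to the group of invertible elements of this algebra).
   Context: $\mathbb{Q}[[X,Y]]$ is the algebra of formal power series in noncommuting variables $X,Y$ over $\mathbb{Q}$, and $\langle\cdot\rangle$ denotes the two-sided ideal generated by the listed elements. In $B_2$ one has $(1+X)^{-1}=1-X$ and $(1+Y)^{-1}=1-Y$. $\langle x,y\,\|\,R\rangle$ denotes the group with generators $x,y$ and defining relations $R$. *)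

theory Defs
  imports "HOL-Algebra.Algebra"
begin

section \<open>Groups given by generators and relations\<close>

text \<open>In a word over the generators of type \<open>'g\<close>, the letter \<open>(g, True)\<close> stands for \<open>g\<close>
  and \<open>(g, False)\<close> for the formal inverse of \<open>g\<close>.\<close>

type_synonym 'g word = "('g \<times> bool) list"

inductive cancels :: "'g word \<Rightarrow> 'g word \<Rightarrow> bool" where
  "cancels (u @ (g, b) # (g, \<not> b) # v) (u @ v)"

definition free_rel :: "('g word \<times> 'g word) set" where
  "free_rel = {(u, v). equivclp cancels u v}"

definition free_class :: "'g word \<Rightarrow> 'g word set" where
  "free_class w = free_rel `` {w}"

definition free_group :: "'g word set monoid" where
  "free_group = \<lparr>carrier = UNIV // free_rel,
     monoid.mult = (\<lambda>A B. \<Union>u\<in>A. \<Union>v\<in>B. free_class (u @ v)),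
     one = free_class []\<rparr>"

definition normal_closure :: "('a, 'm) monoid_scheme \<Rightarrow> 'a set \<Rightarrow> 'a set" where
  "normal_closure G S = \<Inter>{N. N \<lhd> G \<and> S \<subseteq> N}"

text \<open>A pair \<open>(u, v)\<close> in \<open>R\<close> is the defining relation \<open>u = v\<close>; the generators are all the
  elements of the type \<open>'g\<close>.\<close>

definition relators :: "('g word \<times> 'g word) set \<Rightarrow> 'g word set set" where
  "relators R =
     {free_class u \<otimes>\<^bsub>free_group\<^esub> inv\<^bsub>free_group\<^esub> (free_class v) | u v. (u, v) \<in> R}"

definition presented_group :: "('g word \<times> 'g word) set \<Rightarrow> 'g word set set monoid" where
  "presented_group R = free_group Mod (normal_closure free_group (relators R))"

definition presented_gen :: "('g word \<times> 'g word) set \<Rightarrow> 'g \<Rightarrow> 'g word set set" where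
  "presented_gen R g =
     normal_closure free_group (relators R) #>\<^bsub>free_group\<^esub> free_class [(g, True)]"

lemma equiv_free_rel: "equiv UNIV free_rel"
  by (intro equivI) (auto simp: free_rel_def refl_on_def sym_def trans_def
      intro: equivclp_sym equivclp_trans)

lemma free_class_eq_iff: "free_class u = free_class v \<longleftrightarrow> (u, v) \<in> free_rel"
  unfolding free_class_def using eq_equiv_class_iff[OF equiv_free_rel] by simp

lemma carrier_free_group: "carrier free_group = range free_class"
  by (auto simp: free_group_def quotient_def free_class_def)

lemma free_rel_context:
  assumes "(u, v) \<in> free_rel"
  shows "(a @ u @ b, a @ v @ b) \<in> free_rel"
proof -
  have step: "cancels (a @ u @ b) (a @ v @ b)" if "cancels u v" for u v
    using that
  proof cases
    case (1 p g c q)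
    then show ?thesis using cancels.intros[of "a @ p" g c "q @ b"] by simp
  qed
  have "equivclp cancels u v" using assms by (simp add: free_rel_def)
  then have "equivclp cancels (a @ u @ b) (a @ v @ b)"
  proof (induction rule: equivclp_induct)
    case base
    show ?case by simp
  next
    case (step y z)
    then show ?case using \<open>\<And>u v. cancels u v \<Longrightarrow> _\<close>
      by (meson equivclp_into_equivclp)
  qed
  then show ?thesis by (simp add: free_rel_def)
qed

lemma mult_free_class:
  "free_class u \<otimes>\<^bsub>free_group\<^esub> free_class v = free_class (u @ v)"
proof -
  have eq: "free_class (a @ b) = free_class (u @ v)" if "a \<in> free_class u" "b \<in> free_class v" for a b
  proof -
    have "(u, a) \<in> free_rel" "(v, b) \<in> free_rel"
      using that by (auto simp: free_class_def)
    then have "(u @ v, a @ v) \<in> free_rel" "(a @ v, a @ b) \<in> free_rel"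
      using free_rel_context[of u a "[]" v] free_rel_context[of v b a "[]"] by simp_all
    then show ?thesis by (metis free_class_eq_iff)
  qed
  have "u \<in> free_class u" "v \<in> free_class v"
    using equiv_class_self[OF equiv_free_rel] by (simp_all add: free_class_def)
  then have "(\<Union>a\<in>free_class u. \<Union>b\<in>free_class v. free_class (a @ b)) = free_class (u @ v)"
    using eq by blast
  then show ?thesis
    by (simp add: free_group_def)
qed

lemma one_free_group: "\<one>\<^bsub>free_group\<^esub> = free_class []"
  by (simp add: free_group_def)

definition inv_word :: "'g word \<Rightarrow> 'g word" where
  "inv_word w = rev (map (\<lambda>(g, b). (g, \<not> b)) w)"

lemma free_class_inv_word: "free_class (inv_word w @ w) = free_class []"
proof (induction w)
  case Nil
  then show ?case by (simp add: inv_word_def)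
next
  case (Cons l w)
  obtain g b where l: "l = (g, b)" by force
  have "cancels (inv_word w @ (g, \<not> b) # (g, \<not> \<not> b) # w) (inv_word w @ w)"
    by (rule cancels.intros)
  then have "cancels (inv_word (l # w) @ (l # w)) (inv_word w @ w)"
    by (simp add: l inv_word_def)
  then have "free_class (inv_word (l # w) @ (l # w)) = free_class (inv_word w @ w)"
    by (auto simp: free_class_eq_iff free_rel_def)
  then show ?case using Cons.IH by simp
qed

lemma group_free_group: "group (free_group :: 'g word set monoid)"
proof (rule groupI)
  fix x :: "'g word set" assume "x \<in> carrier free_group"
  then obtain w where "x = free_class w" by (auto simp: carrier_free_group)
  then show "\<exists>y\<in>carrier free_group. y \<otimes>\<^bsub>free_group\<^esub> x = \<one>\<^bsub>free_group\<^esub>"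
    by (intro bexI[of _ "free_class (inv_word w)"])
      (simp_all add: carrier_free_group mult_free_class one_free_group free_class_inv_word)
qed (auto simp: carrier_free_group mult_free_class one_free_group)

lemma inv_free_class: "inv\<^bsub>free_group\<^esub> (free_class w) = free_class (inv_word w)"
proof (rule group.inv_equality[OF group_free_group])
qed (simp_all add: mult_free_class one_free_group free_class_inv_word carrier_free_group)

lemma normal_closure_normal:
  assumes "group G" "S \<subseteq> carrier G"
  shows "normal_closure G S \<lhd> G"
proof -
  interpret group G by fact
  have "carrier G \<lhd> G" by (rule normal_self)
  then have ne: "{N. N \<lhd> G \<and> S \<subseteq> N} \<noteq> {}" using assms by auto
  then have "subgroup (normal_closure G S) G"
    unfolding normal_closure_def by (intro subgroups_Inter) (auto intro: normal_imp_subgroup)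
  then show ?thesis
    unfolding normal_inv_iff normal_closure_def by (auto intro: normal.inv_op_closed2)
qed

lemma relators_closed: "relators R \<subseteq> carrier free_group"
  by (auto simp: relators_def inv_free_class mult_free_class carrier_free_group)

lemma group_presented_group: "group (presented_group R)"
  unfolding presented_group_def
  by (intro normal.factorgroup_is_group normal_closure_normal group_free_group relators_closed)


section \<open>Formal power series in noncommuting variables over the rationals\<close>

text \<open>A series is the family of its coefficients, indexed by the noncommutative monomials,
  that is, by the words in the variables of type \<open>'v\<close>.\<close>

definition nc_fps :: "('v list \<Rightarrow> rat) ring" where
  "nc_fps = \<lparr>carrier = UNIV,
     monoid.mult = (\<lambda>f g w. \<Sum>i\<le>length w. f (take i w) * g (drop i w)),
     one = (\<lambda>w. if w = [] then 1 else 0),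
     ring.zero = (\<lambda>w. 0),
     ring.add = (\<lambda>f g w. f w + g w)\<rparr>"

definition nc_var :: "'v \<Rightarrow> 'v list \<Rightarrow> rat" where
  "nc_var v = (\<lambda>w. if w = [v] then 1 else 0)"

lemma ring_nc_fps: "ring (nc_fps :: ('v list \<Rightarrow> rat) ring)"
proof (rule ringI)
  show "abelian_group (nc_fps :: ('v list \<Rightarrow> rat) ring)"
  proof (rule abelian_groupI)
    fix f :: "'v list \<Rightarrow> rat"
    show "\<exists>g\<in>carrier nc_fps. g \<oplus>\<^bsub>nc_fps\<^esub> f = \<zero>\<^bsub>nc_fps\<^esub>"
      by (rule bexI[of _ "\<lambda>w. - f w"]) (auto simp: nc_fps_def)
  qed (simp_all add: nc_fps_def add_ac)
  show "monoid (nc_fps :: ('v list \<Rightarrow> rat) ring)"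
  proof (rule monoidI)
    fix f g h :: "'v list \<Rightarrow> rat"
    show "f \<otimes>\<^bsub>nc_fps\<^esub> g \<otimes>\<^bsub>nc_fps\<^esub> h = f \<otimes>\<^bsub>nc_fps\<^esub> (g \<otimes>\<^bsub>nc_fps\<^esub> h)"
    proof
      fix w :: "'v list"
      let ?n = "length w"
      let ?t = "\<lambda>j i. f (take j w) * g (drop j (take i w)) * h (drop i w)"
      have "(f \<otimes>\<^bsub>nc_fps\<^esub> g \<otimes>\<^bsub>nc_fps\<^esub> h) w = (\<Sum>i\<le>?n. \<Sum>j\<le>i. ?t j i)"
        unfolding nc_fps_def by (simp add: sum_distrib_right min.absorb1 min.absorb2)
      also have "\<dots> = (\<Sum>(j, i)\<in>{(j, i). j \<le> i \<and> i \<le> ?n}. ?t j i)"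
        by (subst sum.Sigma, simp, simp)
          (rule sum.reindex_bij_witness[where i = "\<lambda>(j, i). (i, j)" and j = "\<lambda>(i, j). (j, i)"], auto)
      also have "\<dots> = (\<Sum>(j, k)\<in>(SIGMA j:{..?n}. {..?n - j}). ?t j (j + k))"
        by (rule sum.reindex_bij_witness
            [where i = "\<lambda>(j, k). (j, j + k)" and j = "\<lambda>(j, i). (j, i - j)"]) auto
      also have "\<dots> = (\<Sum>j\<le>?n. \<Sum>k\<le>?n - j. ?t j (j + k))"
        by (subst sum.Sigma) auto
      also have "\<dots> = (f \<otimes>\<^bsub>nc_fps\<^esub> (g \<otimes>\<^bsub>nc_fps\<^esub> h)) w"
      proof -
        have "drop (j + k) w = drop k (drop j w)" for j k by (simp add: add.commute)
        then show ?thesis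
          unfolding nc_fps_def by (simp add: sum_distrib_left mult.assoc drop_take del: drop_drop)
      qed
      finally show "(f \<otimes>\<^bsub>nc_fps\<^esub> g \<otimes>\<^bsub>nc_fps\<^esub> h) w = (f \<otimes>\<^bsub>nc_fps\<^esub> (g \<otimes>\<^bsub>nc_fps\<^esub> h)) w" .
    qed
  next
    fix f :: "'v list \<Rightarrow> rat"
    have "(\<Sum>i\<le>length w. (if take i w = [] then 1 else 0) * f (drop i w)) = f w" for w
    proof -
      have "(\<Sum>i\<le>length w. (if take i w = [] then 1 else 0) * f (drop i w))
          = (\<Sum>i\<le>length w. if i = 0 then f w else 0)"
        by (intro sum.cong) auto
      then show ?thesis by simp
    qed
    then show "\<one>\<^bsub>nc_fps\<^esub> \<otimes>\<^bsub>nc_fps\<^esub> f = f"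
      by (simp add: nc_fps_def)
    have "(\<Sum>i\<le>length w. f (take i w) * (if length w \<le> i then 1 else 0)) = f w" for w
    proof -
      have "(\<Sum>i\<le>length w. f (take i w) * (if length w \<le> i then 1 else 0))
          = (\<Sum>i\<le>length w. if i = length w then f w else 0)"
        by (intro sum.cong) auto
      then show ?thesis by simp
    qed
    then show "f \<otimes>\<^bsub>nc_fps\<^esub> \<one>\<^bsub>nc_fps\<^esub> = f"
      by (simp add: nc_fps_def)
  qed (simp_all add: nc_fps_def)
qed (simp_all add: nc_fps_def distrib_left distrib_right sum.distrib)

text \<open>\<^const>\<open>ideal\<close> and \<^const>\<open>genideal\<close> are two-sided; the lemma applies to both quotients
  taken below.\<close>

lemma (in ring) genideal_ideal_Quot_ring:
  assumes "S \<subseteq> carrier R"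
  shows "ideal (Idl S) R" "ring (R Quot (Idl S))"
  using genideal_ideal[OF assms] ideal.quotient_is_ring by blast+


section \<open>The group and the algebras\<close>

datatype gen = gen_x | gen_y

datatype var = var_X | var_Y

abbreviation (input) "lx \<equiv> (gen_x, True)"
abbreviation (input) "lx' \<equiv> (gen_x, False)"
abbreviation (input) "ly \<equiv> (gen_y, True)"
abbreviation (input) "ly' \<equiv> (gen_y, False)"

definition G2_rels :: "(gen word \<times> gen word) set" where
  "G2_rels =
     {([lx, ly', lx', ly, lx],
       [ly', ly', lx, ly, lx', ly', lx, ly, ly])}"

definition G2 :: "gen word set set monoid" where
  "G2 = presented_group G2_rels"

definition G2_x :: "gen word set set" where "G2_x = presented_gen G2_rels gen_x"
definition G2_y :: "gen word set set" where "G2_y = presented_gen G2_rels gen_y"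

definition B2_ideal :: "(var list \<Rightarrow> rat) set" where
  "B2_ideal = Idl\<^bsub>nc_fps\<^esub> {nc_var var_X \<otimes>\<^bsub>nc_fps\<^esub> nc_var var_X, nc_var var_Y \<otimes>\<^bsub>nc_fps\<^esub> nc_var var_Y}"

definition B2 :: "(var list \<Rightarrow> rat) set ring" where
  "B2 = nc_fps Quot B2_ideal"

definition B2_X :: "(var list \<Rightarrow> rat) set" where "B2_X = B2_ideal +>\<^bsub>nc_fps\<^esub> nc_var var_X"
definition B2_Y :: "(var list \<Rightarrow> rat) set" where "B2_Y = B2_ideal +>\<^bsub>nc_fps\<^esub> nc_var var_Y"

definition C2_ideal :: "(var list \<Rightarrow> rat) set set" where
  "C2_ideal = Idl\<^bsub>B2\<^esub> {(B2_X \<otimes>\<^bsub>B2\<^esub> B2_Y) \<ominus>\<^bsub>B2\<^esub> (B2_Y \<otimes>\<^bsub>B2\<^esub> B2_X)}"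

text \<open>\<open>C2\<close> is the quotient of \<open>B2\<close> by the ideal generated by \<open>XY - YX\<close>.\<close>

definition C2 :: "(var list \<Rightarrow> rat) set set ring" where
  "C2 = B2 Quot C2_ideal"

definition C2_X :: "(var list \<Rightarrow> rat) set set" where "C2_X = C2_ideal +>\<^bsub>B2\<^esub> B2_X"
definition C2_Y :: "(var list \<Rightarrow> rat) set set" where "C2_Y = C2_ideal +>\<^bsub>B2\<^esub> B2_Y"

lemma group_G2: "group G2"
  unfolding G2_def by (rule group_presented_group)

lemma ring_B2: "ring B2"
  unfolding B2_def B2_ideal_def
  by (rule ring.genideal_ideal_Quot_ring(2)[OF ring_nc_fps]) (simp add: nc_fps_def)

lemma B2_XY_closed: "B2_X \<in> carrier B2" "B2_Y \<in> carrier B2"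
  by (auto simp: B2_def B2_X_def B2_Y_def FactRing_def A_RCOSETS_def' a_r_coset_def' nc_fps_def)

lemma ring_C2: "ring C2"
proof -
  interpret ring B2 by (rule ring_B2)
  show ?thesis
    unfolding C2_def C2_ideal_def
    by (rule genideal_ideal_Quot_ring(2)) (simp add: B2_XY_closed)
qed

end

(* Modulo X^2 = Y^2 = 0 and XY = YX the elements 1 + X and 1 + Y are commuting units, and once x
   and y commute both sides of the defining relation of G_2 collapse to x. *)

theory Submission
  imports Defs
begin

text \<open>By von Dyck's theorem, elements of a group that satisfy the defining relations of a
  presentation are the images of its generators under a homomorphism.
  \<open>presented_group_hom_exists\<close> proves this for any target group: evaluation of words is
  invariant under cancellation, so it descends to the free group, and its kernel, being normal,
  contains the normal closure of the relators. It remains to check 1 + X and 1 + Y in the unit group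
  of \<open>C2\<close>. They are units because X and Y square to zero
  (\<open>one_plus_square_zero_Units\<close>), they commute because X and Y do
  (\<open>C2_squares_zero\<close>, \<open>C2_commute\<close>), and commuting elements satisfy the
  relation of \<open>G2\<close> (\<open>commute_imp_G2_relation\<close>).\<close>

fun letter_val :: "('a, 'm) monoid_scheme \<Rightarrow> ('g \<Rightarrow> 'a) \<Rightarrow> 'g \<times> bool \<Rightarrow> 'a" where
  "letter_val H f (g, b) = (if b then f g else inv\<^bsub>H\<^esub> (f g))"

primrec word_val :: "('a, 'm) monoid_scheme \<Rightarrow> ('g \<Rightarrow> 'a) \<Rightarrow> 'g word \<Rightarrow> 'a" where
  "word_val H f [] = \<one>\<^bsub>H\<^esub>"
| "word_val H f (l # w) = letter_val H f l \<otimes>\<^bsub>H\<^esub> word_val H f w"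

context group
begin

lemma letter_val_closed:
  assumes "range f \<subseteq> carrier G"
  shows "letter_val G f l \<in> carrier G"
  using assms by (cases l) auto

lemma word_val_closed:
  assumes "range f \<subseteq> carrier G"
  shows "word_val G f w \<in> carrier G"
  using assms by (induction w) (simp_all add: letter_val_closed)

lemma word_val_append:
  assumes "range f \<subseteq> carrier G"
  shows "word_val G f (u @ v) = word_val G f u \<otimes> word_val G f v"
  using assms by (induction u) (simp_all add: letter_val_closed word_val_closed m_assoc)

text \<open>An adjacent pair of mutually inverse letters contributes a factor 1 to the product; this
  makes evaluation well defined on reduction classes.\<close>

lemma word_val_cancels:
  assumes f: "range f \<subseteq> carrier G" and "cancels u v"
  shows "word_val G f u = word_val G f v"
  using assms(2)
proof cases
  case (1 p g b q)
  have g: "f g \<in> carrier G" using f by auto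
  have "letter_val G f (g, b) \<otimes> (letter_val G f (g, \<not> b) \<otimes> word_val G f q) = word_val G f q"
    using g word_val_closed[OF f] by (simp add: m_assoc[symmetric])
  then show ?thesis by (simp add: 1 word_val_append[OF f])
qed

lemma word_val_free_rel:
  assumes f: "range f \<subseteq> carrier G" and "(u, v) \<in> free_rel"
  shows "word_val G f u = word_val G f v"
proof -
  have "equivclp cancels u v" using assms(2) by (simp add: free_rel_def)
  then show ?thesis
    by (induction rule: equivclp_induct) (auto dest: word_val_cancels[OF f])
qed

text \<open>Universal property of the free group: evaluation is constant on classes, and
  concatenation of words becomes multiplication of values.\<close>

lemma free_group_hom_exists:
  assumes f: "range f \<subseteq> carrier G"
  obtains h where "h \<in> hom free_group G" "\<And>w. h (free_class w) = word_val G f w"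
proof
  \<comment> \<open>Any representative of the class will do, by
    \<open>word_val_free_rel\<close>.\<close>
  define h where "h A = word_val G f (SOME w. free_class w = A)" for A
  show h: "h (free_class w) = word_val G f w" for w
  proof -
    have "free_class (SOME v. free_class v = free_class w) = free_class w"
      by (rule someI[of _ w]) simp
    then show ?thesis
      unfolding h_def by (intro word_val_free_rel[OF f]) (simp add: free_class_eq_iff)
  qed
  show "h \<in> hom free_group G"
    by (rule homI)
      (auto simp: carrier_free_group mult_free_class h word_val_append[OF f] word_val_closed[OF f])
qed

text \<open>Von Dyck's theorem: the homomorphism from the free group kills every relator, hence
  their normal closure, and so factors through the quotient.\<close>

lemma presented_group_hom_exists:
  fixes f :: "'g \<Rightarrow> 'a"
  assumes f: "range f \<subseteq> carrier G"
    and rel: "\<And>u v. (u, v) \<in> R \<Longrightarrow> word_val G f u = word_val G f v"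
  shows "\<exists>\<rho>\<in>hom (presented_group R) G. \<forall>g. \<rho> (presented_gen R g) = f g"
proof -
  obtain h where h: "h \<in> hom free_group G" and hw: "\<And>w. h (free_class w) = word_val G f w"
    using free_group_hom_exists[OF f] by blast
  interpret h: group_hom free_group G h
    using h by (intro group_hom.intro group_free_group group_axioms group_hom_axioms.intro)
  let ?N = "normal_closure free_group (relators R)"
  have "relators R \<subseteq> kernel free_group G h"
  proof
    fix z assume "z \<in> relators R"
    then obtain u v where uv: "(u, v) \<in> R"
      and z: "z = free_class u \<otimes>\<^bsub>free_group\<^esub> inv\<^bsub>free_group\<^esub> (free_class v)"
      by (auto simp: relators_def)
    have c: "free_class w \<in> carrier free_group" for w :: "'g word"
      by (simp add: carrier_free_group)
    then have "h z = \<one>"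
      by (simp add: z hw rel[OF uv] word_val_closed[OF f])
    then show "z \<in> kernel free_group G h"
      using c by (simp add: kernel_def z)
  qed
  \<comment> \<open>The kernel is itself one of the normal subgroups being intersected.\<close>
  then have "?N \<subseteq> kernel free_group G h"
    unfolding normal_closure_def using h.normal_kernel by blast
  moreover have "?N \<lhd> free_group"
    by (intro normal_closure_normal group_free_group relators_closed)
  ultimately obtain \<rho> where \<rho>: "\<rho> \<in> hom (free_group Mod ?N) G"
    and eq: "\<And>x. x \<in> carrier free_group \<Longrightarrow> \<rho> (?N #>\<^bsub>free_group\<^esub> x) = h x"
    using h.FactGroup_universal_kernel by metis
  have "\<rho> (presented_gen R g) = f g" for g
    using f by (simp add: presented_gen_def eq hw carrier_free_group image_subset_iff)
  then show ?thesis using \<rho> by (auto simp: presented_group_def)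
qed

text \<open>In an abelian setting each side has total exponent 1 in \<open>a\<close> and 0 in
  \<open>b\<close>, so both equal \<open>a\<close>. The bracketing to the right is the shape that
  \<open>word_val\<close> produces.\<close>

lemma commute_imp_G2_relation:
  assumes a: "a \<in> carrier G" and b: "b \<in> carrier G" and comm: "a \<otimes> b = b \<otimes> a"
  shows "a \<otimes> (inv b \<otimes> (inv a \<otimes> (b \<otimes> a))) =
    inv b \<otimes> (inv b \<otimes> (a \<otimes> (b \<otimes> (inv a \<otimes> (inv b \<otimes> (a \<otimes> (b \<otimes> b)))))))"
proof -
  have cancel: "inv c \<otimes> (c \<otimes> d) = d" if "c \<in> carrier G" "d \<in> carrier G" for c d
    using that by (simp add: m_assoc[symmetric])
  \<comment> \<open>\<open>abb\<close> and \<open>bab\<close> rewrite the same product, moving one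
    or two factors \<open>b\<close> to the front, to meet one or two factors
    \<open>inv b\<close>.\<close>
  have abb: "a \<otimes> (b \<otimes> b) = b \<otimes> (a \<otimes> b)"
    using a b comm m_assoc[of a b b] m_assoc[of b a b] by simp
  have bab: "a \<otimes> (b \<otimes> b) = b \<otimes> (b \<otimes> a)"
    using abb comm by simp
  have "inv a \<otimes> (inv b \<otimes> (a \<otimes> (b \<otimes> b))) = b"
    using a b by (simp add: abb cancel)
  then have "inv b \<otimes> (inv b \<otimes> (a \<otimes> (b \<otimes> (inv a \<otimes> (inv b \<otimes> (a \<otimes> (b \<otimes> b))))))) = a"
    using a b by (simp add: bab cancel)
  moreover have "a \<otimes> (inv b \<otimes> (inv a \<otimes> (b \<otimes> a))) = a"
    using a b by (simp add: comm[symmetric] cancel)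
  ultimately show ?thesis by simp
qed

end

text \<open>The inverse is the geometric series 1 - x + x^2 - ..., which stops after 1 - x.\<close>

lemma (in ring) one_plus_square_zero_Units:
  assumes x: "x \<in> carrier R" and sq: "x \<otimes> x = \<zero>"
  shows "\<one> \<oplus> x \<in> Units R"
proof -
  have "(\<one> \<oplus> x) \<otimes> (\<one> \<ominus> x) = \<one>" "(\<one> \<ominus> x) \<otimes> (\<one> \<oplus> x) = \<one>"
    using x sq by (simp_all add: minus_eq l_distr r_distr r_minus l_minus a_assoc r_neg l_neg)
  then show ?thesis
    using x by (auto simp: Units_def)
qed

lemma (in ideal) Quot_eq_zero:
  assumes "a \<in> I"
  shows "I +> a = \<zero>\<^bsub>R Quot I\<^esub>"
  using assms by (simp add: FactRing_def a_rcos_const)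

text \<open>Both quotient maps, \<open>nc_fps\<close> to \<open>B2\<close> to \<open>C2\<close>, are
  ring homomorphisms. The squares vanish under the first, and the commutator of X and Y under the
  second, as generators of the respective ideals.\<close>

lemma C2_squares_zero:
  "C2_X \<otimes>\<^bsub>C2\<^esub> C2_X = \<zero>\<^bsub>C2\<^esub>" "C2_Y \<otimes>\<^bsub>C2\<^esub> C2_Y = \<zero>\<^bsub>C2\<^esub>"
  and C2_commute: "C2_X \<otimes>\<^bsub>C2\<^esub> C2_Y = C2_Y \<otimes>\<^bsub>C2\<^esub> C2_X"
  and C2_XY_closed: "C2_X \<in> carrier C2" "C2_Y \<in> carrier C2"
proof -
  interpret A: ring "nc_fps :: (var list \<Rightarrow> rat) ring" by (rule ring_nc_fps)
  interpret B: ring B2 by (rule ring_B2)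
  interpret C: ring C2 by (rule ring_C2)
  have c: "f \<in> carrier nc_fps" for f :: "var list \<Rightarrow> rat"
    by (simp add: nc_fps_def)
  interpret I: ideal B2_ideal nc_fps
    unfolding B2_ideal_def by (rule A.genideal_ideal) (simp add: c)
  interpret p: ring_hom_ring nc_fps B2 "(+>\<^bsub>nc_fps\<^esub>) B2_ideal"
    unfolding B2_def by (rule I.rcos_ring_hom_ring)
  let ?c = "(B2_X \<otimes>\<^bsub>B2\<^esub> B2_Y) \<ominus>\<^bsub>B2\<^esub> (B2_Y \<otimes>\<^bsub>B2\<^esub> B2_X)"
  interpret J: ideal C2_ideal B2
    unfolding C2_ideal_def by (rule B.genideal_ideal) (simp add: B2_XY_closed)
  interpret q: ring_hom_ring B2 C2 "(+>\<^bsub>B2\<^esub>) C2_ideal"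
    unfolding C2_def by (rule J.rcos_ring_hom_ring)
  show "C2_X \<in> carrier C2" "C2_Y \<in> carrier C2"
    by (simp_all add: C2_X_def C2_Y_def B2_XY_closed)
  have "nc_var v \<otimes>\<^bsub>nc_fps\<^esub> nc_var v \<in> B2_ideal" for v
    unfolding B2_ideal_def by (cases v) (auto intro: subsetD[OF A.genideal_self] simp: c)
  then have "B2_ideal +>\<^bsub>nc_fps\<^esub> (nc_var v \<otimes>\<^bsub>nc_fps\<^esub> nc_var v) = \<zero>\<^bsub>B2\<^esub>" for v
    using I.Quot_eq_zero by (simp add: B2_def)
  then have "B2_X \<otimes>\<^bsub>B2\<^esub> B2_X = \<zero>\<^bsub>B2\<^esub>" "B2_Y \<otimes>\<^bsub>B2\<^esub> B2_Y = \<zero>\<^bsub>B2\<^esub>"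
    unfolding B2_X_def B2_Y_def using p.hom_mult c by metis+
  then show "C2_X \<otimes>\<^bsub>C2\<^esub> C2_X = \<zero>\<^bsub>C2\<^esub>" "C2_Y \<otimes>\<^bsub>C2\<^esub> C2_Y = \<zero>\<^bsub>C2\<^esub>"
    unfolding C2_X_def C2_Y_def using q.hom_mult q.hom_zero B2_XY_closed by metis+
  have "?c \<in> C2_ideal"
    unfolding C2_ideal_def by (rule subsetD[OF B.genideal_self]) (simp_all add: B2_XY_closed)
  then have "C2_ideal +>\<^bsub>B2\<^esub> (B2_X \<otimes>\<^bsub>B2\<^esub> B2_Y) = C2_ideal +>\<^bsub>B2\<^esub> (B2_Y \<otimes>\<^bsub>B2\<^esub> B2_X)"
    using B.quotient_eq_iff_same_a_r_cos[OF J.is_ideal] B2_XY_closed by simp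
  then show "C2_X \<otimes>\<^bsub>C2\<^esub> C2_Y = C2_Y \<otimes>\<^bsub>C2\<^esub> C2_X"
    unfolding C2_X_def C2_Y_def using B2_XY_closed by simp
qed

theorem proposition6p5:
  shows "\<exists>\<rho> \<in> hom G2 (units_of C2).
           \<rho> G2_x = \<one>\<^bsub>C2\<^esub> \<oplus>\<^bsub>C2\<^esub> C2_X \<and> \<rho> G2_y = \<one>\<^bsub>C2\<^esub> \<oplus>\<^bsub>C2\<^esub> C2_Y"
proof -
  interpret C: ring C2 by (rule ring_C2)
  interpret U: group "units_of C2" by (rule C.units_group)
  define a b where "a = \<one>\<^bsub>C2\<^esub> \<oplus>\<^bsub>C2\<^esub> C2_X" and "b = \<one>\<^bsub>C2\<^esub> \<oplus>\<^bsub>C2\<^esub> C2_Y"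
  have ab: "a \<in> carrier (units_of C2)" "b \<in> carrier (units_of C2)"
    by (simp_all add: a_def b_def units_of_carrier C.one_plus_square_zero_Units
        C2_XY_closed C2_squares_zero)
  \<comment> \<open>Both products expand to 1 + X + Y + XY, up to the order of X and Y in the last
    term.\<close>
  have comm: "a \<otimes>\<^bsub>units_of C2\<^esub> b = b \<otimes>\<^bsub>units_of C2\<^esub> a"
    by (simp add: a_def b_def units_of_mult C.l_distr C.r_distr C2_XY_closed C2_commute C.a_ac)
  define f where "f = case_gen a b"
  have f: "range f \<subseteq> carrier (units_of C2)"
    using ab by (auto simp: f_def split: gen.split)
  have "word_val (units_of C2) f u = word_val (units_of C2) f v" if "(u, v) \<in> G2_rels" for u v
    using that ab U.commute_imp_G2_relation[OF ab comm]
    by (simp add: G2_rels_def f_def)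
  then obtain \<rho> where "\<rho> \<in> hom (presented_group G2_rels) (units_of C2)"
    and "\<And>g. \<rho> (presented_gen G2_rels g) = f g"
    using U.presented_group_hom_exists[OF f, of G2_rels] by blast
  then show ?thesis
    unfolding G2_def G2_x_def G2_y_def
    by (intro bexI[of _ \<rho>] conjI) (simp_all add: f_def a_def b_def)
qed

end
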